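(* Let $F_S$, $F_R$, $F_{S\otimes R}$ be functors on the category of sets, with semantic structures $((\Omega_S,\preceq_S),\tau_S)$ for $F_S$, $((\Omega_R,\preceq_R),\tau_R)$ for $F_R$ and $((\Omega_{S\otimes R},\preceq),\tau_{S\otimes R})$ for $F_{S\otimes R}$. Let $\lambda$ be a distributive law from $F_S$ and $F_R$ to $F_{S\otimes R}$, and let $q\colon \Omega_S\times\Omega_R\to\Omega_{S\otimes R}$ be a map (the query). Assume: (i) $q(\bot,\bot)=\bot$; (ii) for all $\omega$-chains $(t_i)_{i\in\mathbb{N}}$ in $\Omega_S$ and $(t'_j)_{j\in\mathbb{N}}$ in $\Omega_R$, $q\big(\bigvee_{i} t_i,\bigvee_{j} t'_j\big)=\bigvee_{k\in\mathbb{N}} q(t_k,t'_k)$; (iii) $q\circ(\tau_S\times\tau_R)=\tau_{S\otimes R}\circ F_{S\otimes R}(q)\circ\lambda_{\Omega_S,\Omega_R}$ as maps $F_S(\Omega_S)\times F_R(\Omega_R)\to\Omega_{S\otimes R}$. Then the product construction with $\tau_{S\otimes R}$ is correct with respect to $q$, i.e. for all sets $X,Y$ and all coalgebras $c\colon X\to F_S(X)$ and $d\colon Y\to F_R(Y)$, $$[\![c\otimes_\lambda d]\!]=q\circ([\![c]\!]\times[\![d]\!])\colon X\times Y\to\Omega_{S\otimes R}.$$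
   Context: All functors are endofunctors on the category of sets. A coalgebra for a functor $F$ with state set $X$ is a map $c\colon X\to F(X)$. An $\omega$-cpo is a partially ordered set with a least element $\bot$ in which every $\omega$-chain (increasing sequence $t_0\preceq t_1\preceq\cdots$) has a supremum. A semantic structure for $F$ is a pair of an $\omega$-cpo $(\Omega,\preceq)$ and a map $\tau\colon F(\Omega)\to\Omega$ (the modality). For a coalgebra $c\colon X\to F(X)$, the predicate transformer $\Phi_{\tau,c}\colon\Omega^X\to\Omega^X$ is $\Phi_{\tau,c}(u)=\tau\circ F(u)\circ c$, where $\Omega^X$ carries the pointwise order; as a standing assumption of the paper, all predicate transformers considered are $\omega$-continuous (preserve suprema of $\omega$-chains). The semantics $[\![c]\!]\colon X\to\Omega$ of $c$ is the least fixed point of $\Phi_{\tau,c}$. A distributive law $\lambda$ from $F_S$ and $F_R$ to $F_{S\otimes R}$ is a family of maps $\lambda_{X,Y}\colon F_S(X)\times F_R(Y)\to F_{S\otimes R}(X\times Y)$, one for each pair of sets, natural in $X$ and $Y$: for all $f\colon X\to U$, $g\colon Y\to V$, $\lambda_{U,V}\circ(F_S(f)\times F_R(g))=F_{S\otimes R}(f\times g)\circ\lambda_{X,Y}$. The coalgebraic product of $c\colon X\to F_S(X)$ and $d\colon Y\to F_R(Y)$ is the coalgebra $c\otimes_\lambda d=\lambda_{X,Y}\circ(c\times d)\colon X\times Y\to F_{S\otimes R}(X\times Y)$. Here $[\![c]\!]$, $[\![d]\!]$, $[\![c\otimes_\lambda d]\!]$ are computed with $\tau_S$, $\tau_R$,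 $\tau_{S\otimes R}$ respectively. *)

theory Defs
  imports "HOL-Algebra.Complete_Lattice" "HOL-Library.FuncSet"
begin

section \<open>The category of sets\<close>

text \<open>
  HOL has no type of all sets and no quantification over type constructors. The category of
  sets is therefore rendered relative to a universe \<open>'a elt\<close>: its objects are all sets of
  elements of the universe, and the morphisms from X to Y are the extensional functions
  \<open>X \<rightarrow>\<^sub>E Y\<close>, so that equality of morphisms is HOL equality. Since \<open>'a\<close> is an arbitrary type,
  the universe is as large as one wishes. The constructor \<open>Tup\<close> makes it closed under ordered
  pairs, so that cartesian products of objects are again objects.
\<close>

datatype 'a elt = Atom 'a | Tup "'a elt" "'a elt"

definition set_prod :: "'a elt set \<Rightarrow> 'a elt set \<Rightarrow> 'a elt set"  (infixr \<open>\<otimes>\<^sub>s\<close> 75) where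
  "X \<otimes>\<^sub>s Y = {Tup x y | x y. x \<in> X \<and> y \<in> Y}"

definition map_pair :: "'a elt set \<Rightarrow> 'a elt set \<Rightarrow> ('a elt \<Rightarrow> 'a elt) \<Rightarrow> ('a elt \<Rightarrow> 'a elt)
    \<Rightarrow> ('a elt \<Rightarrow> 'a elt)" where
  "map_pair X Y f g = (\<lambda>p\<in>X \<otimes>\<^sub>s Y. case p of Tup x y \<Rightarrow> Tup (f x) (g y))"

text \<open>
  The values of a functor are sets over a type \<open>'f\<close> that may differ from the universe: no type
  contains, say, all of its own subsets, so requiring \<open>'f = 'a elt\<close> would exclude the powerset
  functor. Endofunctors of the universe are the instance \<open>'f = 'a elt\<close>.
\<close>

record ('a, 'f) set_functor =
  Ob :: "'a elt set \<Rightarrow> 'f set"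
  Mor :: "'a elt set \<Rightarrow> 'a elt set \<Rightarrow> ('a elt \<Rightarrow> 'a elt) \<Rightarrow> ('f \<Rightarrow> 'f)"

definition is_functor :: "('a, 'f) set_functor \<Rightarrow> bool" where
  "is_functor F \<longleftrightarrow>
     (\<forall>X Y. \<forall>f \<in> X \<rightarrow>\<^sub>E Y. Mor F X Y f \<in> Ob F X \<rightarrow>\<^sub>E Ob F Y) \<and>
     (\<forall>X. Mor F X X (\<lambda>x\<in>X. x) = (\<lambda>t\<in>Ob F X. t)) \<and>
     (\<forall>X Y Z. \<forall>f \<in> X \<rightarrow>\<^sub>E Y. \<forall>g \<in> Y \<rightarrow>\<^sub>E Z.
        Mor F X Z (compose X g f) = compose (Ob F X) (Mor F Y Z g) (Mor F X Y f))"

section \<open>Omega-cpos\<close>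

definition is_omega_chain :: "'b gorder \<Rightarrow> (nat \<Rightarrow> 'b) \<Rightarrow> bool" where
  "is_omega_chain L t \<longleftrightarrow> (\<forall>i. t i \<in> carrier L) \<and> (\<forall>i. t i \<sqsubseteq>\<^bsub>L\<^esub> t (Suc i))"

definition omega_cpo :: "'b gorder \<Rightarrow> bool" where
  "omega_cpo L \<longleftrightarrow> partial_order L \<and> (\<exists>b. least L b (carrier L)) \<and>
     (\<forall>t. is_omega_chain L t \<longrightarrow> (\<exists>s. is_lub L s (range t)))"

text \<open>
  Preservation of a supremum is stated with \<^const>\<open>is_lub\<close>, which asserts that the supremum of
  the image exists; an equation between \<open>\<Squnion>\<close>-terms would not, \<open>\<Squnion>\<close> being total.
\<close>

definition omega_continuous :: "'b gorder \<Rightarrow> ('b \<Rightarrow> 'b) \<Rightarrow> bool" where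
  "omega_continuous L \<Phi> \<longleftrightarrow> \<Phi> \<in> carrier L \<rightarrow> carrier L \<and>
     (\<forall>t. is_omega_chain L t \<longrightarrow> is_lub L (\<Phi> (\<Squnion>\<^bsub>L\<^esub> (range t))) (range (\<lambda>i. \<Phi> (t i))))"

definition pointwise :: "'c set \<Rightarrow> 'b gorder \<Rightarrow> ('c \<Rightarrow> 'b) gorder" where
  "pointwise X L = \<lparr>carrier = X \<rightarrow>\<^sub>E carrier L, eq = (=), le = (\<lambda>u v. \<forall>x\<in>X. u x \<sqsubseteq>\<^bsub>L\<^esub> v x)\<rparr>"

section \<open>Coalgebras and their semantics\<close>

definition semantic_structure ::
  "('a, 'f) set_functor \<Rightarrow> 'a elt gorder \<Rightarrow> ('f \<Rightarrow> 'a elt) \<Rightarrow> bool" where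
  "semantic_structure F \<Omega> \<tau> \<longleftrightarrow> omega_cpo \<Omega> \<and> \<tau> \<in> Ob F (carrier \<Omega>) \<rightarrow>\<^sub>E carrier \<Omega>"

definition coalgebra :: "('a, 'f) set_functor \<Rightarrow> 'a elt set \<Rightarrow> ('a elt \<Rightarrow> 'f) \<Rightarrow> bool" where
  "coalgebra F X c \<longleftrightarrow> c \<in> X \<rightarrow>\<^sub>E Ob F X"

definition pred_trans :: "('a, 'f) set_functor \<Rightarrow> 'a elt gorder \<Rightarrow> ('f \<Rightarrow> 'a elt) \<Rightarrow>
    'a elt set \<Rightarrow> ('a elt \<Rightarrow> 'f) \<Rightarrow> ('a elt \<Rightarrow> 'a elt) \<Rightarrow> ('a elt \<Rightarrow> 'a elt)" where
  "pred_trans F \<Omega> \<tau> X c u = compose X \<tau> (compose X (Mor F X (carrier \<Omega>) u) c)"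

definition semantics :: "('a, 'f) set_functor \<Rightarrow> 'a elt gorder \<Rightarrow> ('f \<Rightarrow> 'a elt) \<Rightarrow>
    'a elt set \<Rightarrow> ('a elt \<Rightarrow> 'f) \<Rightarrow> ('a elt \<Rightarrow> 'a elt)" where
  "semantics F \<Omega> \<tau> X c =
     (THE u. least (pointwise X \<Omega>) u (fps (pointwise X \<Omega>) (pred_trans F \<Omega> \<tau> X c)))"

section \<open>Distributive laws and coalgebraic products\<close>

definition distributive_law ::
  "('a, 's) set_functor \<Rightarrow> ('a, 'r) set_functor \<Rightarrow> ('a, 'p) set_functor \<Rightarrow>
   ('a elt set \<Rightarrow> 'a elt set \<Rightarrow> 's \<times> 'r \<Rightarrow> 'p) \<Rightarrow> bool" where
  "distributive_law FS FR FSR lam \<longleftrightarrow>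
     (\<forall>X Y. lam X Y \<in> Ob FS X \<times> Ob FR Y \<rightarrow>\<^sub>E Ob FSR (X \<otimes>\<^sub>s Y)) \<and>
     (\<forall>X U Y V. \<forall>f \<in> X \<rightarrow>\<^sub>E U. \<forall>g \<in> Y \<rightarrow>\<^sub>E V.
        compose (Ob FS X \<times> Ob FR Y) (lam U V) (map_prod (Mor FS X U f) (Mor FR Y V g)) =
        compose (Ob FS X \<times> Ob FR Y) (Mor FSR (X \<otimes>\<^sub>s Y) (U \<otimes>\<^sub>s V) (map_pair X Y f g)) (lam X Y))"

definition coalg_prod :: "('a elt set \<Rightarrow> 'a elt set \<Rightarrow> 's \<times> 'r \<Rightarrow> 'p) \<Rightarrow>
    'a elt set \<Rightarrow> 'a elt set \<Rightarrow> ('a elt \<Rightarrow> 's) \<Rightarrow> ('a elt \<Rightarrow> 'r) \<Rightarrow> ('a elt \<Rightarrow> 'p)" where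
  "coalg_prod lam X Y c d = (\<lambda>p\<in>X \<otimes>\<^sub>s Y. case p of Tup x y \<Rightarrow> lam X Y (c x, d y))"

end

theory Submission
  imports Defs
begin

text \<open>
  By Kleene's theorem each semantics is the supremum of the iterates of its predicate transformer
  on the constant map \<open>\<bottom>\<close>. Naturality of the distributive law together with (iii) says that
  \<open>q \<circ> (u \<times> v)\<close> is sent by the predicate transformer of the product to \<open>q \<circ> (\<Phi> u \<times> \<Phi> v)\<close>, so with
  (i) the iterates for the product are the \<open>q\<close>-images of pairs of iterates, and (ii) passes to the
  supremum.
\<close>

section \<open>Suprema and least elements of omega-cpos\<close>

text \<open>\<open>\<Squnion>\<close> is a choice among least upper bounds, and antisymmetry leaves
  only one candidate. This links \<open>is_lub\<close> facts with equations between suprema.\<close>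

lemma Sup_eqI:
  assumes "partial_order L" and "is_lub L s A"
  shows "\<Squnion>\<^bsub>L\<^esub> A = s"
proof -
  interpret partial_order L by fact
  show ?thesis
    unfolding sup_def using assms(2) by (intro some_equality) (auto intro: least_unique)
qed

lemma bottom_eqI:
  assumes "partial_order L" and "least L b (carrier L)"
  shows "\<bottom>\<^bsub>L\<^esub> = b"
proof -
  interpret partial_order L by fact
  show ?thesis
    unfolding bottom_def using assms(2) by (intro some_equality) (auto intro: least_unique)
qed

text \<open>\<open>Upper\<close> only constrains those elements of a set that lie in the carrier. As
  every \<open>t i\<close> lies there, this proviso disappears and the bounds can be indexed by
  \<open>i\<close>.\<close>

lemma is_lub_range_iff:
  assumes "\<And>i. t i \<in> carrier L"
  shows "is_lub L s (range t) \<longleftrightarrow> s \<in> carrier L \<and> (\<forall>i. t i \<sqsubseteq>\<^bsub>L\<^esub> s) \<and>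
    (\<forall>u\<in>carrier L. (\<forall>i. t i \<sqsubseteq>\<^bsub>L\<^esub> u) \<longrightarrow> s \<sqsubseteq>\<^bsub>L\<^esub> u)"
  using assms by (auto simp: least_def Upper_def)

lemma omega_cpo_bottom:
  assumes "omega_cpo L"
  shows "\<bottom>\<^bsub>L\<^esub> \<in> carrier L" and "\<And>x. x \<in> carrier L \<Longrightarrow> \<bottom>\<^bsub>L\<^esub> \<sqsubseteq>\<^bsub>L\<^esub> x"
proof -
  obtain b where "partial_order L" "least L b (carrier L)"
    using assms by (auto simp: omega_cpo_def)
  then show "\<bottom>\<^bsub>L\<^esub> \<in> carrier L" and "\<And>x. x \<in> carrier L \<Longrightarrow> \<bottom>\<^bsub>L\<^esub> \<sqsubseteq>\<^bsub>L\<^esub> x"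
    using bottom_eqI[of L b] by (auto simp: least_def)
qed

lemma omega_cpo_is_lub_Sup:
  assumes "omega_cpo L" and "is_omega_chain L t"
  shows "is_lub L (\<Squnion>\<^bsub>L\<^esub> (range t)) (range t)"
  using assms Sup_eqI unfolding omega_cpo_def by metis

section \<open>Kleene's fixed point theorem\<close>

text \<open>Monotonicity is not built into \<open>omega_continuous\<close>. It comes from applying
  continuity to the chain x, y, y, ..., whose supremum is \<open>y\<close>: the value
  \<open>\<Phi> y\<close> is then an upper bound of an image containing
  \<open>\<Phi> x\<close>.\<close>

lemma omega_continuous_mono:
  assumes "partial_order L" and "omega_continuous L \<Phi>"
    and x: "x \<in> carrier L" and y: "y \<in> carrier L" and xy: "x \<sqsubseteq>\<^bsub>L\<^esub> y"
  shows "\<Phi> x \<sqsubseteq>\<^bsub>L\<^esub> \<Phi> y"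
proof -
  interpret partial_order L by fact
  have \<Phi>: "\<Phi> \<in> carrier L \<rightarrow> carrier L"
    using assms(2) by (simp add: omega_continuous_def)
  define t where "t i = (if i = 0 then x else y)" for i :: nat
  have chain: "is_omega_chain L t"
    using x y xy by (auto simp: is_omega_chain_def t_def)
  have t0: "t 0 = x" and t1: "t (Suc 0) = y"
    by (simp_all add: t_def)
  have "is_lub L y (range t)"
  proof (subst is_lub_range_iff)
    show "\<And>i. t i \<in> carrier L"
      using x y by (simp add: t_def)
    have "y \<sqsubseteq>\<^bsub>L\<^esub> u" if "\<forall>i. t i \<sqsubseteq>\<^bsub>L\<^esub> u" for u
      using that t1 by metis
    then show "y \<in> carrier L \<and> (\<forall>i. t i \<sqsubseteq>\<^bsub>L\<^esub> y) \<and>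
        (\<forall>u\<in>carrier L. (\<forall>i. t i \<sqsubseteq>\<^bsub>L\<^esub> u) \<longrightarrow> y \<sqsubseteq>\<^bsub>L\<^esub> u)"
      using y xy by (auto simp: t_def)
  qed
  then have "\<Squnion>\<^bsub>L\<^esub> (range t) = y"
    by (rule Sup_eqI[OF assms(1)])
  with assms(2) chain have "is_lub L (\<Phi> y) (range (\<lambda>i. \<Phi> (t i)))"
    by (auto simp: omega_continuous_def)
  moreover have "\<Phi> (t i) \<in> carrier L" for i
    using \<Phi> x y by (auto simp: t_def)
  ultimately have "\<Phi> (t 0) \<sqsubseteq>\<^bsub>L\<^esub> \<Phi> y"
    using is_lub_range_iff[of "\<lambda>i. \<Phi> (t i)" L "\<Phi> y"] by simp
  then show ?thesis
    by (simp add: t0)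
qed

lemma funpow_bottom_omega_chain:
  assumes "omega_cpo L" and "omega_continuous L \<Phi>"
  shows "is_omega_chain L (\<lambda>n. (\<Phi> ^^ n) \<bottom>\<^bsub>L\<^esub>)"
proof -
  have po: "partial_order L"
    using assms(1) by (simp add: omega_cpo_def)
  have \<Phi>: "\<Phi> \<in> carrier L \<rightarrow> carrier L"
    using assms(2) by (simp add: omega_continuous_def)
  have closed: "(\<Phi> ^^ n) \<bottom>\<^bsub>L\<^esub> \<in> carrier L" for n
    by (induction n) (use \<Phi> omega_cpo_bottom(1)[OF assms(1)] in auto)
  have "(\<Phi> ^^ n) \<bottom>\<^bsub>L\<^esub> \<sqsubseteq>\<^bsub>L\<^esub> (\<Phi> ^^ Suc n) \<bottom>\<^bsub>L\<^esub>" for n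
  proof (induction n)
    case 0
    then show ?case
      using closed[of 1] omega_cpo_bottom(2)[OF assms(1)] by simp
  next
    case (Suc n)
    then show ?case
      using omega_continuous_mono[OF po assms(2) closed[of n] closed[of "Suc n"]] by simp
  qed
  with closed show ?thesis
    by (simp add: is_omega_chain_def)
qed

text \<open>By continuity, \<open>\<Phi>\<close> sends the supremum of the iterates to the supremum
  of the iterates from index 1 on. Dropping the initial \<open>\<bottom>\<close> does not change a
  supremum, so it is a fixed point. Any other fixed point bounds all iterates, by induction and
  monotonicity.\<close>

lemma kleene_least_fixed_point:
  assumes "omega_cpo L" and "omega_continuous L \<Phi>"
  shows "least L (\<Squnion>\<^bsub>L\<^esub> (range (\<lambda>n. (\<Phi> ^^ n) \<bottom>\<^bsub>L\<^esub>))) (fps L \<Phi>)"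
proof -
  have po: "partial_order L"
    using assms(1) by (simp add: omega_cpo_def)
  interpret partial_order L by fact
  have \<Phi>: "\<Phi> \<in> carrier L \<rightarrow> carrier L"
    using assms(2) by (simp add: omega_continuous_def)
  define t where "t n = (\<Phi> ^^ n) \<bottom>\<^bsub>L\<^esub>" for n
  define s where "s = \<Squnion>\<^bsub>L\<^esub> (range t)"
  have chain: "is_omega_chain L t"
    using funpow_bottom_omega_chain[OF assms] by (simp add: t_def[abs_def])
  then have closed: "t n \<in> carrier L" for n
    by (simp add: is_omega_chain_def)
  have bot: "t 0 \<sqsubseteq>\<^bsub>L\<^esub> x" if "x \<in> carrier L" for x
    using that omega_cpo_bottom(2)[OF assms(1)] by (simp add: t_def)
  have "is_lub L s (range t)"
    unfolding s_def by (rule omega_cpo_is_lub_Sup[OF assms(1) chain])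
  then have s: "s \<in> carrier L" and ub: "t n \<sqsubseteq>\<^bsub>L\<^esub> s"
    and lub: "\<And>u. u \<in> carrier L \<Longrightarrow> (\<And>n. t n \<sqsubseteq>\<^bsub>L\<^esub> u) \<Longrightarrow> s \<sqsubseteq>\<^bsub>L\<^esub> u" for n
    using closed by (auto simp: is_lub_range_iff)
  have "is_lub L (\<Phi> s) (range (\<lambda>n. t (Suc n)))"
    using assms(2) chain by (auto simp: omega_continuous_def s_def t_def[abs_def])
  then have ub': "t (Suc n) \<sqsubseteq>\<^bsub>L\<^esub> \<Phi> s"
    and lub': "\<And>u. u \<in> carrier L \<Longrightarrow> (\<And>n. t (Suc n) \<sqsubseteq>\<^bsub>L\<^esub> u) \<Longrightarrow> \<Phi> s \<sqsubseteq>\<^bsub>L\<^esub> u" for n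
    using closed by (auto simp: is_lub_range_iff)
  have \<Phi>s: "\<Phi> s \<in> carrier L"
    using \<Phi> s by auto
  \<comment> \<open>The shifted chain misses only \<open>t 0\<close>, which is
    \<open>\<bottom>\<close> and hence below everything in the carrier.\<close>
  have "t n \<sqsubseteq>\<^bsub>L\<^esub> \<Phi> s" for n
    by (cases n) (use bot ub' \<Phi>s in auto)
  then have "\<Phi> s = s"
    using lub lub' ub s \<Phi>s by (meson le_antisym)
  moreover have "s \<sqsubseteq>\<^bsub>L\<^esub> u" if u: "u \<in> carrier L" "\<Phi> u = u" for u
  proof (rule lub[OF u(1)])
    show "t n \<sqsubseteq>\<^bsub>L\<^esub> u" for n
    proof (induction n)
      case 0
      then show ?case by (rule bot[OF u(1)])
    next
      case (Suc n)
      then show ?case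
        using omega_continuous_mono[OF po assms(2) closed[of n] u(1)] u(2) by (simp add: t_def)
    qed
  qed
  \<comment> \<open>\<open>fps\<close> is phrased with the equivalence \<open>.=\<close> of the
    order; \<open>eq_is_equal\<close> turns it into equality.\<close>
  ultimately have "least L s (fps L \<Phi>)"
    using s by (auto simp: least_def fps_def eq_is_equal)
  then show ?thesis
    by (simp add: s_def t_def[abs_def])
qed

section \<open>The pointwise order on functions into an omega-cpo\<close>

text \<open>Antisymmetry rests on extensionality: the order compares values on \<open>X\<close>
  only, and members of the carrier that agree on \<open>X\<close> are equal.\<close>

lemma pointwise_partial_order:
  assumes "partial_order L"
  shows "partial_order (pointwise X L)"
proof -
  interpret partial_order L by fact
  show ?thesis
  proof
    show "\<And>u v. u \<sqsubseteq>\<^bsub>pointwise X L\<^esub> v \<Longrightarrow> v \<sqsubseteq>\<^bsub>pointwise X L\<^esub> u \<Longrightarrow> u \<in> carrier (pointwise X L) \<Longrightarrow>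
        v \<in> carrier (pointwise X L) \<Longrightarrow> u .=\<^bsub>pointwise X L\<^esub> v"
      by (simp add: pointwise_def) (meson PiE_ext PiE_mem le_antisym)
    show "\<And>u v w. u \<sqsubseteq>\<^bsub>pointwise X L\<^esub> v \<Longrightarrow> v \<sqsubseteq>\<^bsub>pointwise X L\<^esub> w \<Longrightarrow> u \<in> carrier (pointwise X L) \<Longrightarrow>
        v \<in> carrier (pointwise X L) \<Longrightarrow> w \<in> carrier (pointwise X L) \<Longrightarrow> u \<sqsubseteq>\<^bsub>pointwise X L\<^esub> w"
      by (simp add: pointwise_def) (meson PiE_mem le_trans)
  qed (auto simp: pointwise_def)
qed

lemma pointwise_omega_chain_iff:
  "is_omega_chain (pointwise X L) t \<longleftrightarrow>
    (\<forall>i. t i \<in> extensional X) \<and> (\<forall>x\<in>X. is_omega_chain L (\<lambda>i. t i x))"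
  by (auto simp: is_omega_chain_def pointwise_def PiE_def Pi_def)

lemma pointwise_least_bottom:
  assumes "omega_cpo L"
  shows "least (pointwise X L) (\<lambda>x\<in>X. \<bottom>\<^bsub>L\<^esub>) (carrier (pointwise X L))"
  using omega_cpo_bottom[OF assms] by (auto simp: least_def pointwise_def)

text \<open>An upper bound of the chain of functions is exactly a function bounding the chain of
  values at each state, so suprema can be formed state by state. The restriction to \<open>X\<close>
  keeps the result in the carrier.\<close>

lemma pointwise_is_lub:
  assumes "omega_cpo L" and chain: "is_omega_chain (pointwise X L) t"
  shows "is_lub (pointwise X L) (\<lambda>x\<in>X. \<Squnion>\<^bsub>L\<^esub> (range (\<lambda>i. t i x))) (range t)"
proof -
  have carr: "t i \<in> X \<rightarrow>\<^sub>E carrier L" for i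
    using chain by (simp add: is_omega_chain_def pointwise_def)
  have "is_lub L (\<Squnion>\<^bsub>L\<^esub> (range (\<lambda>i. t i x))) (range (\<lambda>i. t i x))" if "x \<in> X" for x
    using assms that by (intro omega_cpo_is_lub_Sup) (auto simp: pointwise_omega_chain_iff)
  then have Sup: "\<Squnion>\<^bsub>L\<^esub> (range (\<lambda>i. t i x)) \<in> carrier L \<and> (\<forall>i. t i x \<sqsubseteq>\<^bsub>L\<^esub> \<Squnion>\<^bsub>L\<^esub> (range (\<lambda>i. t i x))) \<and>
      (\<forall>u\<in>carrier L. (\<forall>i. t i x \<sqsubseteq>\<^bsub>L\<^esub> u) \<longrightarrow> \<Squnion>\<^bsub>L\<^esub> (range (\<lambda>i. t i x)) \<sqsubseteq>\<^bsub>L\<^esub> u)" if "x \<in> X" for x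
    by (subst is_lub_range_iff[symmetric]) (use that carr in \<open>blast dest: PiE_mem\<close>)+
  show ?thesis
    using Sup carr
    by (subst is_lub_range_iff) (auto simp: pointwise_def PiE_mem dest: PiE_mem)
qed

lemma pointwise_omega_cpo:
  assumes "omega_cpo L"
  shows "omega_cpo (pointwise X L)"
  using assms pointwise_partial_order pointwise_least_bottom pointwise_is_lub
  unfolding omega_cpo_def by metis

lemma pointwise_bottom:
  assumes "omega_cpo L"
  shows "\<bottom>\<^bsub>pointwise X L\<^esub> = (\<lambda>x\<in>X. \<bottom>\<^bsub>L\<^esub>)"
  using assms
  by (intro bottom_eqI pointwise_least_bottom pointwise_partial_order) (simp_all add: omega_cpo_def)

lemma pointwise_Sup:
  assumes "omega_cpo L" and "is_omega_chain (pointwise X L) t"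
  shows "\<Squnion>\<^bsub>pointwise X L\<^esub> (range t) = (\<lambda>x\<in>X. \<Squnion>\<^bsub>L\<^esub> (range (\<lambda>i. t i x)))"
  using assms
  by (intro Sup_eqI pointwise_is_lub pointwise_partial_order) (simp_all add: omega_cpo_def)

section \<open>Semantics as a supremum of approximants\<close>

text \<open>These are the Kleene iterates. For an omega-cpo the starting function is the least
  element of \<open>pointwise X \<Omega>\<close>, by \<open>pointwise_bottom\<close>; writing it out
  makes its values at states available.\<close>

definition approximant :: "('a, 'f) set_functor \<Rightarrow> 'a elt gorder \<Rightarrow> ('f \<Rightarrow> 'a elt) \<Rightarrow>
    'a elt set \<Rightarrow> ('a elt \<Rightarrow> 'f) \<Rightarrow> nat \<Rightarrow> ('a elt \<Rightarrow> 'a elt)" where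
  "approximant F \<Omega> \<tau> X c n = (pred_trans F \<Omega> \<tau> X c ^^ n) (\<lambda>x\<in>X. \<bottom>\<^bsub>\<Omega>\<^esub>)"

lemma approximant_simps:
  "approximant F \<Omega> \<tau> X c 0 = (\<lambda>x\<in>X. \<bottom>\<^bsub>\<Omega>\<^esub>)"
  "approximant F \<Omega> \<tau> X c (Suc n) = pred_trans F \<Omega> \<tau> X c (approximant F \<Omega> \<tau> X c n)"
  by (simp_all add: approximant_def)

lemma approximant_omega_chain:
  assumes "omega_cpo \<Omega>" and "omega_continuous (pointwise X \<Omega>) (pred_trans F \<Omega> \<tau> X c)"
  shows "is_omega_chain (pointwise X \<Omega>) (approximant F \<Omega> \<tau> X c)"
  using funpow_bottom_omega_chain[OF pointwise_omega_cpo[OF assms(1)] assms(2)]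
  by (simp add: approximant_def[abs_def] pointwise_bottom[OF assms(1)])

text \<open>Kleene's theorem supplies a least fixed point and antisymmetry its uniqueness, so the
  \<open>THE\<close> in \<open>semantics\<close> denotes it. Its supremum is then evaluated state by
  state.\<close>

lemma semantics_eq_Sup_approximants:
  assumes "omega_cpo \<Omega>" and "omega_continuous (pointwise X \<Omega>) (pred_trans F \<Omega> \<tau> X c)"
  shows "semantics F \<Omega> \<tau> X c = (\<lambda>x\<in>X. \<Squnion>\<^bsub>\<Omega>\<^esub> (range (\<lambda>n. approximant F \<Omega> \<tau> X c n x)))"
proof -
  let ?L = "pointwise X \<Omega>" and ?\<Phi> = "pred_trans F \<Omega> \<tau> X c"
  interpret partial_order ?L
    using assms(1) by (intro pointwise_partial_order) (simp add: omega_cpo_def)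
  have "least ?L (\<Squnion>\<^bsub>?L\<^esub> (range (approximant F \<Omega> \<tau> X c))) (fps ?L ?\<Phi>)"
    using kleene_least_fixed_point[OF pointwise_omega_cpo[OF assms(1)] assms(2)]
    by (simp add: approximant_def[abs_def] pointwise_bottom[OF assms(1)])
  then have "semantics F \<Omega> \<tau> X c = \<Squnion>\<^bsub>?L\<^esub> (range (approximant F \<Omega> \<tau> X c))"
    unfolding semantics_def by (blast intro: the_equality least_unique)
  then show ?thesis
    using pointwise_Sup[OF assms(1) approximant_omega_chain[OF assms]] by simp
qed

section \<open>Products and the predicate transformer of a product coalgebra\<close>

lemma Tup_in_set_prod [simp]: "Tup x y \<in> X \<otimes>\<^sub>s Y \<longleftrightarrow> x \<in> X \<and> y \<in> Y"
  by (auto simp: set_prod_def)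

lemma set_prodE:
  assumes "p \<in> X \<otimes>\<^sub>s Y"
  obtains x y where "p = Tup x y" "x \<in> X" "y \<in> Y"
  using assms by (auto simp: set_prod_def)

lemma map_pair_Tup [simp]: "x \<in> X \<Longrightarrow> y \<in> Y \<Longrightarrow> map_pair X Y f g (Tup x y) = Tup (f x) (g y)"
  by (simp add: map_pair_def)

lemma map_pair_in_PiE:
  assumes "f \<in> X \<rightarrow>\<^sub>E U" and "g \<in> Y \<rightarrow>\<^sub>E V"
  shows "map_pair X Y f g \<in> X \<otimes>\<^sub>s Y \<rightarrow>\<^sub>E U \<otimes>\<^sub>s V"
  using assms by (auto simp: map_pair_def elim!: set_prodE dest: PiE_mem)

text \<open>At a pair of states, functoriality of \<open>FSR\<close> splits off the action of
  \<open>q\<close>, naturality exchanges \<open>lam\<close> with the actions of \<open>u\<close> and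
  \<open>v\<close>, and (iii) replaces \<open>\<tau>SR\<close> after \<open>q\<close> and
  \<open>lam\<close> by \<open>q\<close> after \<open>\<tau>S\<close> and
  \<open>\<tau>R\<close>.\<close>

lemma pred_trans_coalg_prod:
  assumes FS: "is_functor FS" and FR: "is_functor FR" and FSR: "is_functor FSR"
    and lam: "distributive_law FS FR FSR lam"
    and q: "q \<in> carrier \<Omega>S \<otimes>\<^sub>s carrier \<Omega>R \<rightarrow>\<^sub>E carrier \<Omega>SR"
    and mod: "\<And>a b. a \<in> Ob FS (carrier \<Omega>S) \<Longrightarrow> b \<in> Ob FR (carrier \<Omega>R) \<Longrightarrow>
      q (Tup (\<tau>S a) (\<tau>R b)) =
      \<tau>SR (Mor FSR (carrier \<Omega>S \<otimes>\<^sub>s carrier \<Omega>R) (carrier \<Omega>SR) q (lam (carrier \<Omega>S) (carrier \<Omega>R) (a, b)))"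
    and c: "coalgebra FS X c" and d: "coalgebra FR Y d"
    and u: "u \<in> X \<rightarrow>\<^sub>E carrier \<Omega>S" and v: "v \<in> Y \<rightarrow>\<^sub>E carrier \<Omega>R"
  shows "pred_trans FSR \<Omega>SR \<tau>SR (X \<otimes>\<^sub>s Y) (coalg_prod lam X Y c d)
      (compose (X \<otimes>\<^sub>s Y) q (map_pair X Y u v)) =
    compose (X \<otimes>\<^sub>s Y) q
      (map_pair X Y (pred_trans FS \<Omega>S \<tau>S X c u) (pred_trans FR \<Omega>R \<tau>R Y d v))"
    (is "?lhs = ?rhs")
proof (rule extensionalityI[where A = "X \<otimes>\<^sub>s Y"])
  let ?S = "carrier \<Omega>S" and ?R = "carrier \<Omega>R" and ?SR = "carrier \<Omega>SR"
  show "?lhs \<in> extensional (X \<otimes>\<^sub>s Y)" "?rhs \<in> extensional (X \<otimes>\<^sub>s Y)"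
    by (simp_all add: pred_trans_def)
  fix p assume "p \<in> X \<otimes>\<^sub>s Y"
  then obtain x y where p: "p = Tup x y" and x: "x \<in> X" and y: "y \<in> Y"
    by (rule set_prodE)
  have cx: "c x \<in> Ob FS X" and dy: "d y \<in> Ob FR Y"
    using c d x y by (auto simp: coalgebra_def)
  have "Mor FS X ?S u \<in> Ob FS X \<rightarrow>\<^sub>E Ob FS ?S" "Mor FR Y ?R v \<in> Ob FR Y \<rightarrow>\<^sub>E Ob FR ?R"
    using FS FR u v by (auto simp: is_functor_def)
  then have a: "Mor FS X ?S u (c x) \<in> Ob FS ?S" and b: "Mor FR Y ?R v (d y) \<in> Ob FR ?R"
    using cx dy by auto
  \<comment> \<open>The composite in \<open>comp\<close> below is restricted to this object, so
    membership is needed to evaluate it.\<close>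
  have l: "lam X Y (c x, d y) \<in> Ob FSR (X \<otimes>\<^sub>s Y)"
    using lam cx dy by (auto simp: distributive_law_def dest: PiE_mem)
  have "compose (Ob FS X \<times> Ob FR Y) (lam ?S ?R) (map_prod (Mor FS X ?S u) (Mor FR Y ?R v)) =
      compose (Ob FS X \<times> Ob FR Y) (Mor FSR (X \<otimes>\<^sub>s Y) (?S \<otimes>\<^sub>s ?R) (map_pair X Y u v)) (lam X Y)"
    using lam u v unfolding distributive_law_def by blast
  \<comment> \<open>Naturality is an equation between restricted functions; it is read at the pair
    of successor structures of \<open>x\<close> and \<open>y\<close>.\<close>
  from fun_cong[OF this, of "(c x, d y)"]
  have nat: "lam ?S ?R (Mor FS X ?S u (c x), Mor FR Y ?R v (d y)) =
      Mor FSR (X \<otimes>\<^sub>s Y) (?S \<otimes>\<^sub>s ?R) (map_pair X Y u v) (lam X Y (c x, d y))"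
    using cx dy by (simp add: compose_def)
  have comp: "Mor FSR (X \<otimes>\<^sub>s Y) ?SR (compose (X \<otimes>\<^sub>s Y) q (map_pair X Y u v)) =
      compose (Ob FSR (X \<otimes>\<^sub>s Y)) (Mor FSR (?S \<otimes>\<^sub>s ?R) ?SR q)
        (Mor FSR (X \<otimes>\<^sub>s Y) (?S \<otimes>\<^sub>s ?R) (map_pair X Y u v))"
    using FSR q map_pair_in_PiE[OF u v] unfolding is_functor_def by blast
  have "?lhs p = \<tau>SR (Mor FSR (?S \<otimes>\<^sub>s ?R) ?SR q
      (lam ?S ?R (Mor FS X ?S u (c x), Mor FR Y ?R v (d y))))"
    unfolding nat pred_trans_def comp using x y l by (simp add: p compose_def coalg_prod_def)
  also have "\<dots> = ?rhs p"
    unfolding mod[OF a b, symmetric] using x y by (simp add: p compose_def pred_trans_def)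
  finally show "?lhs p = ?rhs p" .
qed

section \<open>Correctness of the product construction\<close>

text \<open>Omega-continuity of the three predicate transformers appears as premises in the
  conclusion, since these transformers depend on the coalgebras. Condition (ii) uses
  \<open>is_lub\<close>, which includes existence of the supremum on its right-hand side.\<close>

theorem theorem4p7:
  fixes FS :: "('a, 's) set_functor"
    and FR :: "('a, 'r) set_functor"
    and FSR :: "('a, 'p) set_functor"
    and \<Omega>S \<Omega>R \<Omega>SR :: "'a elt gorder"
    and \<tau>S :: "'s \<Rightarrow> 'a elt"
    and \<tau>R :: "'r \<Rightarrow> 'a elt"
    and \<tau>SR :: "'p \<Rightarrow> 'a elt"
    and lam :: "'a elt set \<Rightarrow> 'a elt set \<Rightarrow> 's \<times> 'r \<Rightarrow> 'p"
    and q :: "'a elt \<Rightarrow> 'a elt"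
  assumes "is_functor FS" and "is_functor FR" and "is_functor FSR"
    and "semantic_structure FS \<Omega>S \<tau>S"
    and "semantic_structure FR \<Omega>R \<tau>R"
    and "semantic_structure FSR \<Omega>SR \<tau>SR"
    and "distributive_law FS FR FSR lam"
    and "q \<in> carrier \<Omega>S \<otimes>\<^sub>s carrier \<Omega>R \<rightarrow>\<^sub>E carrier \<Omega>SR"
    and bot: "q (Tup \<bottom>\<^bsub>\<Omega>S\<^esub> \<bottom>\<^bsub>\<Omega>R\<^esub>) = \<bottom>\<^bsub>\<Omega>SR\<^esub>"
    and sup: "\<And>t t'. is_omega_chain \<Omega>S t \<Longrightarrow> is_omega_chain \<Omega>R t' \<Longrightarrow>
      is_lub \<Omega>SR (q (Tup (\<Squnion>\<^bsub>\<Omega>S\<^esub> (range t)) (\<Squnion>\<^bsub>\<Omega>R\<^esub> (range t')))) (range (\<lambda>k. q (Tup (t k) (t' k))))"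
    and mod: "\<And>a b. a \<in> Ob FS (carrier \<Omega>S) \<Longrightarrow> b \<in> Ob FR (carrier \<Omega>R) \<Longrightarrow>
      q (Tup (\<tau>S a) (\<tau>R b)) =
      \<tau>SR (Mor FSR (carrier \<Omega>S \<otimes>\<^sub>s carrier \<Omega>R) (carrier \<Omega>SR) q (lam (carrier \<Omega>S) (carrier \<Omega>R) (a, b)))"
  shows "\<forall>X Y c d. coalgebra FS X c \<longrightarrow> coalgebra FR Y d \<longrightarrow>
      omega_continuous (pointwise X \<Omega>S) (pred_trans FS \<Omega>S \<tau>S X c) \<longrightarrow>
      omega_continuous (pointwise Y \<Omega>R) (pred_trans FR \<Omega>R \<tau>R Y d) \<longrightarrow>
      omega_continuous (pointwise (X \<otimes>\<^sub>s Y) \<Omega>SR)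
        (pred_trans FSR \<Omega>SR \<tau>SR (X \<otimes>\<^sub>s Y) (coalg_prod lam X Y c d)) \<longrightarrow>
      semantics FSR \<Omega>SR \<tau>SR (X \<otimes>\<^sub>s Y) (coalg_prod lam X Y c d) =
      compose (X \<otimes>\<^sub>s Y) q (map_pair X Y (semantics FS \<Omega>S \<tau>S X c) (semantics FR \<Omega>R \<tau>R Y d))"
proof (intro allI impI)
  fix X Y c d
  let ?\<Phi>S = "pred_trans FS \<Omega>S \<tau>S X c" and ?\<Phi>R = "pred_trans FR \<Omega>R \<tau>R Y d"
  let ?XY = "X \<otimes>\<^sub>s Y" and ?cd = "coalg_prod lam X Y c d"
  assume c: "coalgebra FS X c" and d: "coalgebra FR Y d"
    and contS: "omega_continuous (pointwise X \<Omega>S) ?\<Phi>S"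
    and contR: "omega_continuous (pointwise Y \<Omega>R) ?\<Phi>R"
    and contSR: "omega_continuous (pointwise ?XY \<Omega>SR) (pred_trans FSR \<Omega>SR \<tau>SR ?XY ?cd)"
  have cpoS: "omega_cpo \<Omega>S" and cpoR: "omega_cpo \<Omega>R" and cpoSR: "omega_cpo \<Omega>SR"
    using assms(4-6) by (simp_all add: semantic_structure_def)
  then have poSR: "partial_order \<Omega>SR"
    by (simp add: omega_cpo_def)
  let ?u = "approximant FS \<Omega>S \<tau>S X c" and ?v = "approximant FR \<Omega>R \<tau>R Y d"
    and ?w = "approximant FSR \<Omega>SR \<tau>SR ?XY ?cd"
  note chainS = approximant_omega_chain[OF cpoS contS]
    and chainR = approximant_omega_chain[OF cpoR contR]
  have u: "?u n \<in> X \<rightarrow>\<^sub>E carrier \<Omega>S" and v: "?v n \<in> Y \<rightarrow>\<^sub>E carrier \<Omega>R" for n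
    using chainS chainR by (simp_all add: is_omega_chain_def pointwise_def)
  \<comment> \<open>Both factors are iterated equally often, which matches the single index
    \<open>k\<close> in (ii). The base case is (i), and outside \<open>?XY\<close> both sides are
    \<open>undefined\<close>.\<close>
  have w: "?w n = compose ?XY q (map_pair X Y (?u n) (?v n))" for n
  proof (induction n)
    case 0
    show ?case
      by (rule extensionalityI[where A = ?XY])
        (auto simp: approximant_simps compose_def restrict_def extensional_def bot elim!: set_prodE)
  next
    case (Suc n)
    show ?case
      unfolding approximant_simps Suc.IH
      by (rule pred_trans_coalg_prod) (fact assms(1-3,7,8) c d u v | rule mod, assumption+)+
  qed
  show "semantics FSR \<Omega>SR \<tau>SR ?XY ?cd =
      compose ?XY q (map_pair X Y (semantics FS \<Omega>S \<tau>S X c) (semantics FR \<Omega>R \<tau>R Y d))"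
    (is "?lhs = ?rhs")
  proof (rule extensionalityI[where A = ?XY])
    show "?lhs \<in> extensional ?XY"
      by (simp add: semantics_eq_Sup_approximants[OF cpoSR contSR])
    show "?rhs \<in> extensional ?XY"
      by simp
    fix p assume "p \<in> ?XY"
    then obtain x y where p: "p = Tup x y" and x: "x \<in> X" and y: "y \<in> Y"
      by (rule set_prodE)
    \<comment> \<open>Condition (ii) concerns chains of values rather than of functions, so the
      states are fixed before it is applied. By \<open>w\<close>, the resulting sequence is that of
      the values of \<open>?w\<close> at \<open>p\<close>.\<close>
    have "is_omega_chain \<Omega>S (\<lambda>n. ?u n x)" "is_omega_chain \<Omega>R (\<lambda>n. ?v n y)"
      using chainS chainR x y by (simp_all add: pointwise_omega_chain_iff)
    from Sup_eqI[OF poSR sup[OF this]] show "?lhs p = ?rhs p"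
      using x y
      by (simp add: p w compose_def semantics_eq_Sup_approximants[OF cpoSR contSR]
          semantics_eq_Sup_approximants[OF cpoS contS] semantics_eq_Sup_approximants[OF cpoR contR])
  qed
qed

end
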